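(* Let $K$ be a field, let $A$ be a configuration of $K[t_1,\ldots,t_d]$ all of whose monomials have the same total degree $r$ and such that every variable $t_i$ divides at least one monomial of $A$, and for each $1\le i\le d$ let $B_i$ be a configuration of a polynomial ring $K[\mathbf{u}^{(i)}]=K[u^{(i)}_1,\ldots,u^{(i)}_{\mu_i}]$. Suppose that $A$ consists of squarefree monomials. Then $K[A],K[B_1],\ldots,K[B_d]$ are all normal if and only if $K[A(B_1,\ldots,B_d)]$ is normal.
   Context: A configuration of a polynomial ring $K[t_1,\ldots,t_d]$ is a finite set $A=\{\mathbf{t}^{\mathbf{a}_1},\ldots,\mathbf{t}^{\mathbf{a}_n}\}$ of (distinct) monomials such that there is $\mathbf{w}\in\mathbb{R}^d$ with $\mathbf{w}\cdot\mathbf{a}_i=1$ for all $i$. The toric ring $K[A]$ is the $K$-subalgebra generated by the monomials in $A$; it is normal if it is integrally closed in its field of fractions. Nested configuration: write $B_i=\{m^{(i)}_1,\ldots,m^{(i)}_{\lambda_i}\}$, where the polynomial rings $K[\mathbf{u}^{(1)}],\ldots,K[\mathbf{u}^{(d)}]$ have pairwise disjoint sets of variables. Then $$A(B_1,\ldots,B_d)=\{m^{(i_1)}_{j_1}\cdots m^{(i_r)}_{j_r} : t_{i_1}\cdots t_{i_r}\in A,\ 1\le j_k\le\lambda_{i_k}\text{ for }1\le k\le r\},$$ a configuration of $K[\mathbf{u}^{(1)},\ldots,\mathbf{u}^{(d)}]$. *)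

theory Defs
  imports
    Complex_Main
    "HOL-Library.Poly_Mapping"
    "HOL-Library.Disjoint_Sets"
    "HOL-Computational_Algebra.Polynomial"
    "HOL-Computational_Algebra.Fraction_Field"
begin

text \<open>
  Polynomials in variables from \<^typ>\<open>nat\<close> over \<^typ>\<open>'k\<close>, as finitely supported functions
  on exponent vectors. A polynomial ring in finitely many variables is the subring of those
  polynomials that involve only variables from a finite set \<open>V\<close>; rings in disjoint sets of variables
  thus live in one common ring.
\<close>

type_synonym 'k mpoly = "(nat \<Rightarrow>\<^sub>0 nat) \<Rightarrow>\<^sub>0 'k"

definition monom_of :: "(nat \<Rightarrow>\<^sub>0 nat) \<Rightarrow> 'k::field mpoly"
  where "monom_of a = Poly_Mapping.single a 1"

definition var :: "nat \<Rightarrow> 'k::field mpoly"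
  where "var i = monom_of (Poly_Mapping.single i 1)"

definition monomials :: "nat set \<Rightarrow> 'k::field mpoly set"
  where "monomials V = {monom_of a | a. Poly_Mapping.keys a \<subseteq> V}"

text \<open>The finite set is required to be nonempty: it is \<open>{t\<^sup>a\<^sub>1, \<dots>, t\<^sup>a\<^sub>n}\<close> with \<open>n \<ge> 1\<close>.\<close>

definition configuration :: "nat set \<Rightarrow> 'k::field mpoly set \<Rightarrow> bool"
  where "configuration V A \<longleftrightarrow>
    finite A \<and> A \<noteq> {} \<and> A \<subseteq> monomials V \<and>
    (\<exists>w :: nat \<Rightarrow> real. \<forall>a. monom_of a \<in> A \<longrightarrow> (\<Sum>i\<in>V. w i * real (Poly_Mapping.lookup a i)) = 1)"

text \<open>The summation over the support gives the total degree for any set of variables.\<close>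

definition homogeneous_of_degree :: "nat \<Rightarrow> 'k::field mpoly set \<Rightarrow> bool"
  where "homogeneous_of_degree r A \<longleftrightarrow>
    (\<forall>a. monom_of a \<in> A \<longrightarrow> (\<Sum>i\<in>Poly_Mapping.keys a. Poly_Mapping.lookup a i) = r)"

definition squarefree_monomials :: "'k::field mpoly set \<Rightarrow> bool"
  where "squarefree_monomials A \<longleftrightarrow>
    (\<forall>a. monom_of a \<in> A \<longrightarrow> (\<forall>i. Poly_Mapping.lookup a i \<le> 1))"

text \<open>Constants are \<^term>\<open>Poly_Mapping.single 0 c\<close>; closure under subtraction follows from \<open>-1 \<in> K\<close>.\<close>

definition is_subalgebra :: "'k::field mpoly set \<Rightarrow> bool"
  where "is_subalgebra S \<longleftrightarrow>
    (\<forall>c. Poly_Mapping.single 0 c \<in> S) \<and> (\<forall>f\<in>S. \<forall>g\<in>S. f + g \<in> S \<and> f * g \<in> S)"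

definition toric_ring :: "'k::field mpoly set \<Rightarrow> 'k mpoly set"
  where "toric_ring A = is_subalgebra hull A"

text \<open>
  For a subring \<open>R\<close> of an integral domain, the field of fractions of \<open>R\<close> is taken inside the field of
  fractions of the ambient domain, in which \<open>R\<close> is embedded by \<open>a \<mapsto> a / 1\<close>.
\<close>

definition fractions_of :: "'a::idom set \<Rightarrow> 'a fract set"
  where "fractions_of R = {Fract a b | a b. a \<in> R \<and> b \<in> R \<and> b \<noteq> 0}"

definition integral_over :: "'a::comm_ring_1 set \<Rightarrow> 'a \<Rightarrow> bool"
  where "integral_over S x \<longleftrightarrow>
    (\<exists>p. lead_coeff p = 1 \<and> (\<forall>n. coeff p n \<in> S) \<and> poly p x = 0)"

definition normal_domain :: "'a::idom set \<Rightarrow> bool"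
  where "normal_domain R \<longleftrightarrow>
    (\<forall>x \<in> fractions_of R.
      integral_over ((\<lambda>a. Fract a 1) ` R) x \<longrightarrow> x \<in> (\<lambda>a. Fract a 1) ` R)"

text \<open>
  The factors of \<open>t\<close>-monomials are read as sequences \<open>i\<^sub>1, \<dots>, i\<^sub>r\<close>, and
  \<open>m k\<close> is the monomial chosen from \<open>B\<^bsub>i\<^sub>k\<^esub>\<close> for the \<open>k\<close>-th factor.
\<close>

definition nested_configuration ::
    "nat \<Rightarrow> nat \<Rightarrow> 'k::field mpoly set \<Rightarrow> (nat \<Rightarrow> 'k mpoly set) \<Rightarrow> 'k mpoly set"
  where "nested_configuration d r A B =
    {\<Prod>k=1..r. m k | m i.
      (\<forall>k\<in>{1..r}. i k \<in> {1..d}) \<and> (\<Prod>k=1..r. var (i k)) \<in> A \<and> (\<forall>k\<in>{1..r}. m k \<in> B (i k))}"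

end

theory Submission
  imports Defs "HOL-Library.Multiset"
begin

text \<open>
  A toric ring is normal iff its exponent monoid \<open>S\<close> is saturated: \<open>n a = n b + c\<close> with
  \<open>a, b, c \<in> S\<close> and \<open>n > 0\<close> forces \<open>a - b \<in> S\<close>. A normal ring contains the root \<open>t\<^sup>a / t\<^sup>b\<close> of
  \<open>X\<^sup>n - t\<^sup>c\<close>; conversely, an integral fraction over a saturated monoid is divided out term by term,
  with Dickson's lemma both producing the multiples required by saturation and giving termination.

  The weight of a configuration makes the number of generators summing to an exponent vector of
  \<open>B\<^sub>i\<close> well defined. Hence the monoid of the nested configuration consists of the tuples of
  elements of the monoids of the \<open>B\<^sub>i\<close> whose vector of degrees lies in the monoid of \<open>A\<close>, and
  saturation transfers componentwise. Only the descent to \<open>B\<^sub>i\<close> uses squarefreeness: a monomial of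
  \<open>A\<close> divisible by \<open>t\<^sub>i\<close> is linear in \<open>t\<^sub>i\<close>, so its multiples realise every degree in \<open>B\<^sub>i\<close>.
\<close>

section \<open>Toric rings and exponent monoids\<close>

definition exponents :: "'k::field mpoly set \<Rightarrow> (nat \<Rightarrow>\<^sub>0 nat) set"
  where "exponents A = {a. monom_of a \<in> A}"

text \<open>Sums over multisets make a decomposition into generators a single object, so that
  decompositions can be compared by inclusion, as Dickson's lemma does.\<close>

definition gen_monoid :: "'a::comm_monoid_add set \<Rightarrow> 'a set"
  where "gen_monoid G = {\<Sum>\<^sub># M | M. set_mset M \<subseteq> G}"

text \<open>
  On exponent vectors the convolution product makes \<open>of_nat n * a\<close> the \<open>n\<close>-fold sum of \<open>a\<close>.
\<close>

definition saturated :: "'a::comm_semiring_1 set \<Rightarrow> bool"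
  where "saturated S \<longleftrightarrow> (\<forall>a\<in>S. \<forall>b\<in>S. \<forall>c\<in>S. \<forall>n>0.
    of_nat n * a = of_nat n * b + c \<longrightarrow> (\<exists>e\<in>S. a = b + e))"

lemma gen_monoidI: "set_mset M \<subseteq> G \<Longrightarrow> \<Sum>\<^sub># M \<in> gen_monoid G"
  by (auto simp: gen_monoid_def)

lemma gen_monoidE:
  assumes "a \<in> gen_monoid G"
  obtains M where "set_mset M \<subseteq> G" "a = \<Sum>\<^sub># M"
  using assms by (auto simp: gen_monoid_def)

lemma zero_in_gen_monoid: "0 \<in> gen_monoid G"
  using gen_monoidI[of "{#}"] by simp

lemma gen_monoid_add:
  assumes "a \<in> gen_monoid G" "b \<in> gen_monoid G"
  shows "a + b \<in> gen_monoid G"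
proof -
  obtain M N where "set_mset M \<subseteq> G" "a = \<Sum>\<^sub># M" "set_mset N \<subseteq> G" "b = \<Sum>\<^sub># N"
    using assms by (auto elim!: gen_monoidE)
  then show ?thesis
    using gen_monoidI[of "M + N" G] by simp
qed

lemma gen_monoid_generator: "a \<in> G \<Longrightarrow> a \<in> gen_monoid G"
  using gen_monoidI[of "{#a#}"] by simp

lemma gen_monoid_of_nat_mult: "a \<in> gen_monoid G \<Longrightarrow> of_nat n * a \<in> gen_monoid G"
  by (induction n) (auto simp: algebra_simps zero_in_gen_monoid gen_monoid_add)

lemma lookup_of_nat_mult:
  "Poly_Mapping.lookup (of_nat n * a) i = n * Poly_Mapping.lookup a i" for a :: "nat \<Rightarrow>\<^sub>0 nat"
  by (induction n) (simp_all add: algebra_simps lookup_add)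

lemma lookup_sum_mset:
  "Poly_Mapping.lookup (\<Sum>\<^sub># M) i = (\<Sum>a\<in>#M. Poly_Mapping.lookup a i)"
  by (induction M) (simp_all add: lookup_add)

lemma monom_of_eq_iff [simp]: "monom_of a = monom_of b \<longleftrightarrow> a = b"
  by (metis keys_single monom_of_def singleton_inject zero_neq_one)

lemma monom_of_nonzero [simp]: "monom_of a \<noteq> 0"
  by (metis keys_single keys_zero monom_of_def insert_not_empty zero_neq_one)

lemma keys_monom_of [simp]: "Poly_Mapping.keys (monom_of a :: 'k::field mpoly) = {a}"
  by (simp add: monom_of_def)

lemma monom_of_add: "monom_of (a + b) = monom_of a * monom_of b"
  by (simp add: monom_of_def mult_single)

lemma monom_of_0: "monom_of 0 = 1"
  by (simp add: monom_of_def)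

lemma monom_of_sum: "monom_of (\<Sum>i\<in>I. a i) = (\<Prod>i\<in>I. monom_of (a i))"
  by (induction I rule: infinite_finite_induct) (simp_all add: monom_of_add monom_of_0)

lemma monom_of_power: "monom_of a ^ n = monom_of (of_nat n * a)"
  by (induction n) (simp_all add: monom_of_add monom_of_0 algebra_simps)

lemma poly_mapping_eq_sum_single:
  "f = (\<Sum>a\<in>Poly_Mapping.keys f. Poly_Mapping.single a (Poly_Mapping.lookup f a))"
  by (rule poly_mapping_eqI) (auto simp: lookup_sum lookup_single when_def in_keys_iff)

section \<open>Subalgebras and the monomial basis of a toric ring\<close>

lemma is_subalgebra_closed:
  assumes "is_subalgebra S"
  shows subalgebra_const: "Poly_Mapping.single 0 c \<in> S"
    and subalgebra_add: "f \<in> S \<Longrightarrow> g \<in> S \<Longrightarrow> f + g \<in> S"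
    and subalgebra_mult: "f \<in> S \<Longrightarrow> g \<in> S \<Longrightarrow> f * g \<in> S"
    and subalgebra_0: "0 \<in> S"
    and subalgebra_1: "1 \<in> S"
proof -
  show const: "Poly_Mapping.single 0 c \<in> S" for c
    using assms by (simp add: is_subalgebra_def)
  show "0 \<in> S" "1 \<in> S"
    using const[of 0] const[of 1] by simp_all
qed (use assms in \<open>auto simp: is_subalgebra_def\<close>)

lemma subalgebra_uminus:
  assumes "is_subalgebra S" "f \<in> S"
  shows "- f \<in> S"
proof -
  have "Poly_Mapping.single 0 (- 1) * f \<in> S"
    using assms by (intro subalgebra_mult subalgebra_const)
  then show ?thesis by (simp add: single_uminus)
qed

lemma subalgebra_diff: "is_subalgebra S \<Longrightarrow> f \<in> S \<Longrightarrow> g \<in> S \<Longrightarrow> f - g \<in> S"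
  using subalgebra_add[of S f "- g"] subalgebra_uminus[of S g] by simp

lemma subalgebra_power: "is_subalgebra S \<Longrightarrow> f \<in> S \<Longrightarrow> f ^ n \<in> S"
  by (induction n) (auto intro: subalgebra_1 subalgebra_mult)

lemma subalgebra_of_nat: "is_subalgebra S \<Longrightarrow> of_nat n \<in> S"
  by (induction n) (auto intro: subalgebra_0 subalgebra_1 subalgebra_add)

lemma subalgebra_sum:
  assumes "is_subalgebra S" "\<And>i. i \<in> I \<Longrightarrow> f i \<in> S"
  shows "sum f I \<in> S"
  using assms(2)
  by (induction I rule: infinite_finite_induct)
    (auto intro: subalgebra_0[OF assms(1)] subalgebra_add[OF assms(1)])

lemma is_subalgebra_keys_subset:
  "is_subalgebra {f :: 'k::field mpoly. Poly_Mapping.keys f \<subseteq> gen_monoid G}" (is "is_subalgebra ?R")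
  unfolding is_subalgebra_def
proof (intro conjI ballI allI)
  fix f g assume "f \<in> ?R" "g \<in> ?R"
  then show "f + g \<in> ?R" "f * g \<in> ?R"
    using keys_add[of f g] keys_mult[of f g] by (blast intro: gen_monoid_add)+
qed (auto simp: zero_in_gen_monoid)

text \<open>The polynomials supported on the monoid form a subalgebra containing \<open>A\<close>.
  Conversely, a subalgebra containing \<open>A\<close> contains all products of generators, hence
  every term of such a polynomial.\<close>

lemma toric_ring_eq:
  assumes "A \<subseteq> range monom_of"
  shows "toric_ring A = {f. Poly_Mapping.keys f \<subseteq> gen_monoid (exponents A)}" (is "_ = ?R")
proof
  have "A \<subseteq> ?R"
    using assms by (auto simp: exponents_def intro!: gen_monoid_generator)
  then show "toric_ring A \<subseteq> ?R"
    unfolding toric_ring_def by (rule hull_minimal) (rule is_subalgebra_keys_subset)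
next
  have "f \<in> T" if f: "f \<in> ?R" and T: "is_subalgebra T" "A \<subseteq> T" for f T
  proof -
    have monom: "monom_of (\<Sum>\<^sub># M) \<in> T" if "set_mset M \<subseteq> exponents A" for M
      using that
    proof (induction M)
      case empty
      show ?case using T by (simp add: monom_of_0 subalgebra_1)
    next
      case (add a M)
      then show ?case using T by (auto simp: monom_of_add exponents_def intro!: subalgebra_mult)
    qed
    have "Poly_Mapping.single a (Poly_Mapping.lookup f a) \<in> T" if "a \<in> Poly_Mapping.keys f" for a
    proof -
      have "monom_of a \<in> T"
        using f that monom by (auto elim!: gen_monoidE)
      then have "Poly_Mapping.single 0 (Poly_Mapping.lookup f a) * monom_of a \<in> T"
        using T by (intro subalgebra_mult subalgebra_const)
      then show ?thesis by (simp add: monom_of_def mult_single)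
    qed
    then show ?thesis
      by (subst poly_mapping_eq_sum_single) (intro subalgebra_sum T)
  qed
  then show "?R \<subseteq> toric_ring A"
    by (auto simp: toric_ring_def hull_def)
qed

section \<open>Dickson's lemma and descent in finitely generated monoids\<close>

text \<open>Induction on \<open>G\<close>: a further subsequence is monotone at the new index, and
  passing to it keeps the earlier sequences increasing. If it decreases, it is eventually constant,
  so a tail of it increases.\<close>

lemma increasing_subsequence:
  fixes s :: "'a \<Rightarrow> nat \<Rightarrow> nat"
  assumes "finite G"
  shows "\<exists>r. strict_mono r \<and> (\<forall>g\<in>G. incseq (\<lambda>n. s g (r n)))"
  using assms
proof (induction G)
  case empty
  show ?case using strict_mono_id by auto
next
  case (insert g G)
  then obtain r where r: "strict_mono r" "\<forall>h\<in>G. incseq (\<lambda>n. s h (r n))"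
    by blast
  obtain q where q: "strict_mono q" "monoseq (\<lambda>n. s g (r (q n)))"
    using seq_monosub[of "\<lambda>n. s g (r n)"] by blast
  obtain N where N: "incseq (\<lambda>n. s g (r (q (n + N))))"
  proof (cases "incseq (\<lambda>n. s g (r (q n)))")
    case True
    then show ?thesis using that[of 0] by simp
  next
    case False
    then have "decseq (\<lambda>n. s g (r (q n)))"
      using q by (simp add: monoseq_iff)
    \<comment> \<open>The least value attained; from an index \<open>N\<close> attaining it, the
      decreasing sequence stays at \<open>v\<close>.\<close>
    define v where "v = (LEAST v. \<exists>n. v = s g (r (q n)))"
    have "\<exists>n. v = s g (r (q n))"
      unfolding v_def by (rule LeastI) blast
    then obtain N where "v = s g (r (q N))" ..
    moreover have "v \<le> s g (r (q n))" for n
      unfolding v_def by (rule Least_le) blast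
    ultimately have "s g (r (q (n + N))) = v" for n
      using \<open>decseq _\<close> by (auto simp: decseq_def intro: antisym)
    then show ?thesis using that[of N] by simp
  qed
  have "strict_mono (\<lambda>n. r (q (n + N)))"
    using r q by (simp add: strict_mono_def)
  moreover have "incseq (\<lambda>n. s h (r (q (n + N))))" if "h \<in> G" for h
    using r q that by (simp add: incseq_def strict_mono_less_eq)
  ultimately show ?case using N by (intro exI[of _ "\<lambda>n. r (q (n + N))"]) auto
qed

text \<open>A multiset over \<open>G\<close> is a vector of counts. Along a subsequence on which all
  counts increase, the first two members are already comparable.\<close>

lemma dickson_mset:
  fixes M :: "nat \<Rightarrow> 'a multiset"
  assumes "finite G" "\<And>n. set_mset (M n) \<subseteq> G"
  obtains i j where "i < j" "M i \<subseteq># M j"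
proof -
  obtain r where r: "strict_mono r" "\<forall>g\<in>G. incseq (\<lambda>n. count (M (r n)) g)"
    using increasing_subsequence[OF assms(1), of "\<lambda>g n. count (M n) g"] by blast
  have "count (M (r 0)) g \<le> count (M (r 1)) g" for g
  proof (cases "g \<in> G")
    case True
    then show ?thesis using r by (simp add: incseq_def)
  next
    case False
    then show ?thesis using assms(2) by (metis count_eq_zero_iff le0 subset_iff)
  qed
  then have "M (r 0) \<subseteq># M (r 1)" by (simp add: subseteq_mset_def)
  moreover have "r 0 < r 1" using r by (simp add: strict_mono_less)
  ultimately show ?thesis using that by blast
qed

text \<open>Exponent vectors are ordered lexicographically, so the first nonzero entry decides.
  Together with compatibility with addition this yields a monomial order.\<close>

lemma exponent_nonneg: "0 \<le> (a :: nat \<Rightarrow>\<^sub>0 nat)"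
proof (cases "a = 0")
  case False
  define k where "k = (LEAST k. Poly_Mapping.lookup a k \<noteq> 0)"
  have "\<exists>k. Poly_Mapping.lookup a k \<noteq> 0"
    using False by (auto simp: poly_mapping_eq_iff fun_eq_iff)
  then have "Poly_Mapping.lookup a k \<noteq> 0"
    unfolding k_def by (rule LeastI_ex)
  moreover have "Poly_Mapping.lookup a j = 0" if "j < k" for j
    using not_less_Least[OF that[unfolded k_def]] by simp
  ultimately have "less_fun (Poly_Mapping.lookup 0) (Poly_Mapping.lookup a)"
    unfolding less_fun_def by (intro exI[of _ k]) simp
  then show ?thesis by (simp add: less_eq_poly_mapping.rep_eq)
qed simp

text \<open>With infinitely many variables the lexicographic order has infinite descents, such as
  \<open>single 0 1\<close>, \<open>single 1 1\<close>, and so on. Inside a finitely generated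
  monoid, Dickson's lemma finds \<open>i < j\<close> such that \<open>s j\<close> is
  \<open>s i\<close> plus further generators, which contradicts descent.\<close>

lemma wf_less_gen_monoid:
  fixes G :: "(nat \<Rightarrow>\<^sub>0 nat) set"
  assumes "finite G"
  shows "wf {(a, b). a < b \<and> a \<in> gen_monoid G \<and> b \<in> gen_monoid G}"
  unfolding wf_iff_no_infinite_down_chain
proof
  assume "\<exists>s. \<forall>i. (s (Suc i), s i) \<in> {(a, b). a < b \<and> a \<in> gen_monoid G \<and> b \<in> gen_monoid G}"
  then obtain s where s: "\<And>i. s (Suc i) < s i" "\<And>i. s i \<in> gen_monoid G"
    by blast
  have "\<forall>i. \<exists>M. set_mset M \<subseteq> G \<and> s i = \<Sum>\<^sub># M"
    using s(2) by (meson gen_monoidE)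
  then obtain M where M: "\<And>i. set_mset (M i) \<subseteq> G" "\<And>i. s i = \<Sum>\<^sub># (M i)"
    by metis
  obtain i j where ij: "i < j" "M i \<subseteq># M j"
    using dickson_mset[OF assms, of M] M by metis
  then have "s j = s i + \<Sum>\<^sub># (M j - M i)"
    by (metis M(2) subset_mset.add_diff_inverse sum_mset.union)
  then have "s i \<le> s j"
    using add_left_mono[OF exponent_nonneg, of "s i"] by simp
  moreover have "s j < s i"
    using ij(1) by (induction j rule: less_Suc_induct) (auto intro: s(1) less_trans)
  ultimately show False by simp
qed

text \<open>Formally, \<open>c + n (a - b)\<close> lies in the monoid for every \<open>n\<close>.
  For two indices \<open>i < j\<close> with comparable decompositions the offset \<open>c\<close>
  cancels, and the difference \<open>(j - i) (a - b)\<close> is again a sum of generators.\<close>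

lemma multiple_in_gen_monoid:
  fixes G :: "'a::{comm_semiring_1, cancel_comm_monoid_add} set"
  assumes "finite G" and *: "\<And>n. \<exists>h\<in>gen_monoid G. c + of_nat n * a = of_nat n * b + h"
  obtains n s where "n > 0" "s \<in> gen_monoid G" "of_nat n * a = of_nat n * b + s"
proof -
  have "\<forall>n. \<exists>M. set_mset M \<subseteq> G \<and> c + of_nat n * a = of_nat n * b + \<Sum>\<^sub># M"
    by (metis * gen_monoidE)
  then obtain M where M: "\<And>n. set_mset (M n) \<subseteq> G"
      "\<And>n. c + of_nat n * a = of_nat n * b + \<Sum>\<^sub># (M n)"
    by metis
  obtain i j where ij: "i < j" "M i \<subseteq># M j"
    using dickson_mset[OF assms(1), of M] M by metis
  define s where "s = \<Sum>\<^sub># (M j - M i)"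
  have s: "\<Sum>\<^sub># (M j) = \<Sum>\<^sub># (M i) + s"
    unfolding s_def using ij(2) by (metis subset_mset.add_diff_inverse sum_mset.union)
  obtain n where n: "j = i + n" "n > 0"
    using ij(1) less_imp_add_positive by blast
  have "(c + of_nat i * a) + of_nat n * a = c + of_nat j * a"
    by (simp add: n algebra_simps)
  also have "\<dots> = of_nat j * b + (\<Sum>\<^sub># (M i) + s)"
    by (simp only: M(2) s)
  also have "\<dots> = (of_nat i * b + \<Sum>\<^sub># (M i)) + (of_nat n * b + s)"
    by (simp add: n(1) algebra_simps)
  also have "\<dots> = (c + of_nat i * a) + (of_nat n * b + s)"
    by (simp only: M(2))
  finally have "of_nat n * a = of_nat n * b + s"
    by (rule add_left_imp_eq)
  moreover have "s \<in> gen_monoid G"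
    unfolding s_def using M(1) by (meson gen_monoidI in_diffD subset_iff)
  ultimately show ?thesis using that n(2) by blast
qed

section \<open>Normality and saturation\<close>

text \<open>Leading exponent for the lexicographic order. Its value at \<open>0\<close> is an
  unspecified \<open>Max {}\<close>, so zero polynomials are treated separately below.\<close>

definition lead :: "'k::field mpoly \<Rightarrow> nat \<Rightarrow>\<^sub>0 nat"
  where "lead f = Max (Poly_Mapping.keys f)"

lemma lead_in_keys: "f \<noteq> 0 \<Longrightarrow> lead f \<in> Poly_Mapping.keys f"
  by (simp add: lead_def)

lemma le_lead: "a \<in> Poly_Mapping.keys f \<Longrightarrow> a \<le> lead f"
  by (simp add: lead_def)

text \<open>Split each factor into leading term and tail. Tail exponents are strictly smaller, so a
  product involving a tail cannot reach the sum of the leading exponents.\<close>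

lemma lookup_mult_lead:
  "Poly_Mapping.lookup (f * g) (lead f + lead g) =
    Poly_Mapping.lookup f (lead f) * Poly_Mapping.lookup g (lead g)"
proof -
  define p where "p h = Poly_Mapping.single (lead h) (Poly_Mapping.lookup h (lead h))" for h :: "'a mpoly"
  have tail: "a < lead h" if "a \<in> Poly_Mapping.keys (h - p h)" for a h
  proof -
    have "a \<noteq> lead h" "Poly_Mapping.lookup h a \<noteq> 0"
      using that by (auto simp: p_def in_keys_iff lookup_minus lookup_single when_def split: if_splits)
    then show ?thesis using le_lead[of a h] by (auto simp: in_keys_iff)
  qed
  have "lead f + lead g \<notin> Poly_Mapping.keys ((f - p f) * g)"
  proof
    assume "lead f + lead g \<in> Poly_Mapping.keys ((f - p f) * g)"
    then obtain a b where "a \<in> Poly_Mapping.keys (f - p f)" "b \<in> Poly_Mapping.keys g"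
        "lead f + lead g = a + b"
      using keys_mult[of "f - p f" g] by blast
    then show False using add_less_le_mono[OF tail le_lead, of a f b g] by simp
  qed
  moreover have "lead f + lead g \<notin> Poly_Mapping.keys (p f * (g - p g))"
  proof
    assume "lead f + lead g \<in> Poly_Mapping.keys (p f * (g - p g))"
    then obtain b where "b \<in> Poly_Mapping.keys (g - p g)" "lead f + lead g = lead f + b"
      using keys_mult[of "p f" "g - p g"] by (auto simp: p_def split: if_splits)
    then show False using tail by force
  qed
  moreover have "f * g = p f * p g + (f - p f) * g + p f * (g - p g)"
    by (simp add: algebra_simps)
  ultimately show ?thesis
    by (simp add: lookup_add in_keys_iff p_def mult_single)
qed

lemma lead_mult:
  assumes "f \<noteq> 0" "g \<noteq> 0"
  shows "lead (f * g) = lead f + lead g"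
proof -
  have "lead f + lead g \<in> Poly_Mapping.keys (f * g)"
    using assms[THEN lead_in_keys] by (simp add: in_keys_iff lookup_mult_lead)
  moreover have "a \<le> lead f + lead g" if "a \<in> Poly_Mapping.keys (f * g)" for a
    using that keys_mult[of f g] by (auto intro: add_mono le_lead)
  ultimately show ?thesis
    unfolding lead_def[of "f * g"] by (intro Max_eqI) auto
qed

lemma lead_power:
  assumes "f \<noteq> 0"
  shows "lead (f ^ n) = of_nat n * lead f"
proof (induction n)
  case 0
  then show ?case by (simp add: lead_def)
next
  case (Suc n)
  then show ?case using assms by (simp add: lead_mult algebra_simps)
qed

text \<open>
  Comparing leading exponents in \<open>c f\<^sup>n = g\<^sup>n h\<^sub>n\<close> puts a positive multiple of \<open>lead f - lead g\<close>
  into the monoid, so saturation lets the leading term of \<open>f\<close> be divided by that of \<open>g\<close>;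
  the remainder satisfies the same hypothesis.
\<close>

lemma almost_integral_imp_dvd:
  fixes f g c :: "'k::field mpoly" and G :: "(nat \<Rightarrow>\<^sub>0 nat) set"
  defines "R \<equiv> {f. Poly_Mapping.keys f \<subseteq> gen_monoid G}"
  assumes "finite G" "saturated (gen_monoid G)"
    and g: "g \<in> R" "g \<noteq> 0" and c: "c \<in> R" "c \<noteq> 0"
    and "f \<in> R" "\<forall>n. \<exists>h\<in>R. c * f ^ n = g ^ n * h"
  shows "\<exists>q\<in>R. f = g * q"
  \<comment> \<open>The well-founded relation lives on the monoid, so each descent has to show that
    both leading exponents lie there; \<open>lead_R\<close> provides this.\<close>
  using wf_less_gen_monoid[OF \<open>finite G\<close>] assms(8,9)
proof (induction "lead f" arbitrary: f rule: wf_induct_rule)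
  case less
  have R: "is_subalgebra R" unfolding R_def by (rule is_subalgebra_keys_subset)
  have lead_R: "lead h \<in> gen_monoid G" if "h \<in> R" "h \<noteq> 0" for h :: "'k mpoly"
    using that lead_in_keys by (auto simp: R_def)
  show ?case
  proof (cases "f = 0")
    case True
    then show ?thesis using subalgebra_0[OF R] by (intro bexI[of _ 0]) auto
  next
    case False
    have "\<exists>s\<in>gen_monoid G. lead c + of_nat n * lead f = of_nat n * lead g + s" for n
    proof -
      obtain h where h: "h \<in> R" "c * f ^ n = g ^ n * h"
        using less.prems by blast
      then have "h \<noteq> 0"
        using c False by auto
      then have "lead c + of_nat n * lead f = of_nat n * lead g + lead h"
        using arg_cong[OF h(2), of lead] c False g by (simp add: lead_mult lead_power)
      then show ?thesis using lead_R h \<open>h \<noteq> 0\<close> by blast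
    qed
    then obtain n s where "n > 0" "s \<in> gen_monoid G" "of_nat n * lead f = of_nat n * lead g + s"
      using multiple_in_gen_monoid[OF \<open>finite G\<close>] by metis
    then obtain e where e: "e \<in> gen_monoid G" "lead f = lead g + e"
      using assms(3) lead_R less.prems(1) False g unfolding saturated_def by meson
    define k where "k = Poly_Mapping.lookup f (lead f) / Poly_Mapping.lookup g (lead g)"
    define q where "q = Poly_Mapping.single e k"
    define f' where "f' = f - g * q"
    have gf: "Poly_Mapping.lookup g (lead g) \<noteq> 0" "Poly_Mapping.lookup f (lead f) \<noteq> 0"
      using lead_in_keys g False by (auto simp: in_keys_iff)
    then have "k \<noteq> 0" by (simp add: k_def)
    then have lead_q: "lead q = e" "q \<noteq> 0"
      by (simp_all add: q_def lead_def flip: keys_eq_empty)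
    have "q \<in> R" using e by (auto simp: q_def R_def)
    have f': "f' \<in> R"
      unfolding f'_def by (intro subalgebra_diff subalgebra_mult R less.prems g \<open>q \<in> R\<close>)
    have "\<exists>h\<in>R. c * f' ^ n = g ^ n * h" for n
    proof -
      obtain h where h: "\<And>k. h k \<in> R" "\<And>k. c * f ^ k = g ^ k * h k"
        using less.prems(2) by metis
      \<comment> \<open>Binomial expansion of \<open>(f - g q)^n\<close>: in the \<open>k\<close>-th
        summand \<open>c f^k\<close> yields the factor \<open>g^k\<close>, and the power of
        \<open>g q\<close> yields the missing \<open>g^(n-k)\<close>.\<close>
      define H where "H = (\<Sum>k\<le>n. of_nat (n choose k) * (h k * (- q) ^ (n - k)))"
      have "c * f' ^ n = c * (f + g * (- q)) ^ n"
        by (simp add: f'_def)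
      also have "\<dots> = (\<Sum>k\<le>n. of_nat (n choose k) * ((c * f ^ k) * (g * (- q)) ^ (n - k)))"
        unfolding binomial_ring sum_distrib_left by (simp add: mult_ac)
      also have "\<dots> = (\<Sum>k\<le>n. g ^ n * (of_nat (n choose k) * (h k * (- q) ^ (n - k))))"
      proof (rule sum.cong[OF refl])
        fix k assume "k \<in> {..n}"
        then have "g ^ n = g ^ k * g ^ (n - k)"
          by (simp flip: power_add)
        then show "of_nat (n choose k) * ((c * f ^ k) * (g * (- q)) ^ (n - k)) =
            g ^ n * (of_nat (n choose k) * (h k * (- q) ^ (n - k)))"
          unfolding h power_mult_distrib by (simp only: mult_ac)
      qed
      also have "\<dots> = g ^ n * H"
        by (simp add: H_def sum_distrib_left)
      finally have "c * f' ^ n = g ^ n * H" .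
      moreover have "H \<in> R"
        unfolding H_def
        by (intro subalgebra_sum subalgebra_mult subalgebra_power subalgebra_of_nat
            subalgebra_uminus R h \<open>q \<in> R\<close>)
      ultimately show ?thesis by blast
    qed
    moreover have "lead f' < lead f" if "f' \<noteq> 0"
    proof -
      \<comment> \<open>The coefficient \<open>k\<close> of \<open>q\<close> was chosen so that the
        leading terms of \<open>f\<close> and \<open>g q\<close> cancel.\<close>
      have "Poly_Mapping.lookup (g * q) (lead f) = Poly_Mapping.lookup f (lead f)"
        using lookup_mult_lead[of g q] gf
        by (simp add: lead_q flip: e(2)) (simp add: q_def k_def)
      then have "lead f \<notin> Poly_Mapping.keys f'"
        by (simp add: f'_def in_keys_iff lookup_minus)
      moreover have "lead f' \<in> Poly_Mapping.keys f \<union> Poly_Mapping.keys (g * q)"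
        using lead_in_keys[OF that]
        by (auto simp: f'_def in_keys_iff lookup_minus)
      then have "lead f' \<le> lead f"
        using le_lead[of "lead f'" f] le_lead[of "lead f'" "g * q"]
        by (auto simp: lead_mult g lead_q e)
      ultimately show ?thesis
        using lead_in_keys[OF that] by (metis order.not_eq_order_implies_strict)
    qed
    ultimately have "\<exists>q'\<in>R. f' = g * q'"
    \<comment> \<open>For \<open>f' = 0\<close> the value \<open>lead f'\<close> says nothing, so
      the induction hypothesis is reserved for the other case.\<close>
    proof (cases "f' = 0")
      case True
      then show ?thesis using subalgebra_0[OF R] by (intro bexI[of _ 0]) auto
    next
      case f'0: False
      show ?thesis
      proof (rule less.hyps)
        show "(lead f', lead f) \<in> {(a, b). a < b \<and> a \<in> gen_monoid G \<and> b \<in> gen_monoid G}"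
          using \<open>f' \<noteq> 0 \<Longrightarrow> _\<close> f'0 f' lead_R less.prems(1) False by simp
      qed (use f' \<open>\<And>n. \<exists>h\<in>R. c * f' ^ n = g ^ n * h\<close> in auto)
    qed
    then obtain q' where "q' \<in> R" "f' = g * q'" ..
    then have "f = g * (q + q')"
      by (simp add: f'_def algebra_simps)
    then show ?thesis
      using subalgebra_add[OF R \<open>q \<in> R\<close> \<open>q' \<in> R\<close>] by blast
  qed
qed

section \<open>Integral fractions and normality\<close>

lemma Fract_1_simps:
  fixes a b :: "'a::idom"
  shows "Fract a 1 + Fract b 1 = Fract (a + b) 1" "Fract a 1 * Fract b 1 = Fract (a * b) 1"
    "Fract a 1 ^ n = Fract (a ^ n) 1" "Fract a 1 = Fract b 1 \<longleftrightarrow> a = b"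
proof -
  show "Fract a 1 ^ n = Fract (a ^ n) 1"
    by (induction n) (simp_all add: One_fract_def)
qed (simp_all add: eq_fract)

text \<open>For \<open>x = f / g\<close> satisfying a monic equation of degree \<open>m\<close>, the
  element \<open>c = g^m\<close> is a common denominator of all powers of \<open>x\<close>: it
  clears those up to \<open>x^m\<close>, and the equation reduces the higher ones.\<close>

lemma integral_imp_almost_integral:
  fixes f g :: "'k::field mpoly"
  assumes R: "is_subalgebra R" and "f \<in> R" "g \<in> R" "g \<noteq> 0"
    and "integral_over ((\<lambda>a. Fract a 1) ` R) (Fract f g)"
  obtains c where "c \<in> R" "c \<noteq> 0" "\<forall>n. \<exists>h\<in>R. c * f ^ n = g ^ n * h"
proof -
  define x where "x = Fract f g"
  define E where "E = (\<lambda>a. Fract a 1) ` R"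
  have E_mult: "y \<in> E \<Longrightarrow> z \<in> E \<Longrightarrow> y * z \<in> E" and E_add: "y \<in> E \<Longrightarrow> z \<in> E \<Longrightarrow> y + z \<in> E" for y z
    using R by (auto simp: E_def Fract_1_simps intro!: imageI subalgebra_mult subalgebra_add)
  have E_uminus: "- y \<in> E" if "y \<in> E" for y
    using that R by (auto simp: E_def intro!: imageI subalgebra_uminus)
  have E_sum: "sum y I \<in> E" if "\<And>i. i \<in> I \<Longrightarrow> y i \<in> E" for y and I :: "nat set"
    using that
  proof (induction I rule: infinite_finite_induct)
    case empty
    then show ?case using subalgebra_0[OF R] by (auto simp: E_def Zero_fract_def)
  next
    case (infinite I)
    then show ?case using subalgebra_0[OF R] by (auto simp: E_def Zero_fract_def)
  qed (auto intro: E_add)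
  obtain p where p: "lead_coeff p = 1" "\<And>n. coeff p n \<in> E" "poly p x = 0"
    using assms(5) unfolding integral_over_def E_def x_def by blast
  define m where "m = degree p"
  have xg: "Fract g 1 * x = Fract f 1"
    using assms(4) by (simp add: x_def eq_fract)
  have "0 = (\<Sum>i<m. coeff p i * x ^ i) + x ^ m"
    using p by (simp add: poly_altdef m_def lessThan_Suc_atMost[symmetric])
  then have xm: "x ^ m = - (\<Sum>i<m. coeff p i * x ^ i)"
    by (simp add: eq_neg_iff_add_eq_0 add.commute)
  have *: "Fract (g ^ m) 1 * x ^ n \<in> E" for n
  proof (induction n rule: less_induct)
    case (less n)
    show ?case
    proof (cases "n \<le> m")
      case True
      then have "Fract (g ^ m) 1 * x ^ n = Fract (g ^ (m - n)) 1 * (Fract g 1 * x) ^ n"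
        by (simp add: power_mult_distrib Fract_1_simps mult.assoc[symmetric] flip: power_add)
      also have "\<dots> = Fract (g ^ (m - n) * f ^ n) 1"
        by (simp add: xg Fract_1_simps)
      finally show ?thesis
        using assms unfolding E_def by (auto intro!: imageI subalgebra_mult subalgebra_power)
    next
      case False
      \<comment> \<open>One factor \<open>x^m\<close> is rewritten by the equation. The exponents
        \<open>n - m + i\<close> that appear have \<open>i < m\<close>, so they are below
        \<open>n\<close> and the induction hypothesis applies.\<close>
      then have "Fract (g ^ m) 1 * x ^ n = Fract (g ^ m) 1 * (x ^ (n - m) * x ^ m)"
        by (simp flip: power_add)
      also have "\<dots> = - (\<Sum>i<m. coeff p i * (Fract (g ^ m) 1 * x ^ (n - m + i)))"
        unfolding xm by (simp add: sum_distrib_left power_add mult_ac)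
      also have "\<dots> \<in> E"
        using False by (intro E_uminus E_sum E_mult p less) auto
      finally show ?thesis .
    qed
  qed
  show ?thesis
  proof
    show "g ^ m \<in> R" "g ^ m \<noteq> 0"
      using assms by (auto intro: subalgebra_power)
    show "\<forall>n. \<exists>h\<in>R. g ^ m * f ^ n = g ^ n * h"
    proof
      fix n
      obtain h where h: "h \<in> R" "Fract (g ^ m) 1 * x ^ n = Fract h 1"
        using *[of n] by (auto simp: E_def)
      have "Fract (g ^ m * f ^ n) 1 = Fract (g ^ m) 1 * (Fract g 1 * x) ^ n"
        by (simp add: xg Fract_1_simps)
      also have "\<dots> = Fract (g ^ n) 1 * (Fract (g ^ m) 1 * x ^ n)"
        by (simp only: power_mult_distrib Fract_1_simps mult_ac)
      also have "\<dots> = Fract (g ^ n * h) 1"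
        by (simp only: h Fract_1_simps)
      finally show "\<exists>h\<in>R. g ^ m * f ^ n = g ^ n * h"
        using h(1) by (auto simp: Fract_1_simps)
    qed
  qed
qed

text \<open>An integral fraction \<open>f / g\<close> has a common denominator for all its powers,
  and over a saturated monoid this forces \<open>g\<close> to divide \<open>f\<close> within the
  ring.\<close>

lemma saturated_imp_normal:
  assumes "finite A" "A \<subseteq> range monom_of" "saturated (gen_monoid (exponents A))"
  shows "normal_domain (toric_ring A)"
  unfolding normal_domain_def
proof (intro ballI impI)
  fix x assume x: "x \<in> fractions_of (toric_ring A)"
    "integral_over ((\<lambda>a. Fract a 1) ` toric_ring A) x"
  have R: "is_subalgebra (toric_ring A)"
    unfolding toric_ring_eq[OF assms(2)] by (rule is_subalgebra_keys_subset)
  obtain f g where fg: "x = Fract f g" "f \<in> toric_ring A" "g \<in> toric_ring A" "g \<noteq> 0"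
    using x(1) by (auto simp: fractions_of_def)
  obtain c where c: "c \<in> toric_ring A" "c \<noteq> 0"
      "\<forall>n. \<exists>h\<in>toric_ring A. c * f ^ n = g ^ n * h"
    using integral_imp_almost_integral[OF R fg(2-4)] x(2) fg(1) by metis
  have "finite (exponents A)"
    unfolding exponents_def using finite_vimageI[OF assms(1), of monom_of]
    by (simp add: vimage_def inj_on_def)
  then obtain q where q: "q \<in> toric_ring A" "f = g * q"
    using almost_integral_imp_dvd[of "exponents A" g c f] assms(3) fg c
    unfolding toric_ring_eq[OF assms(2)] by metis
  then have "x = Fract q 1"
    using fg by (simp add: eq_fract mult.commute)
  then show "x \<in> (\<lambda>a. Fract a 1) ` toric_ring A"
    using q by blast
qed

text \<open>The fraction \<open>t^a / t^b\<close> is a root of the monic polynomial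
  \<open>X^n - t^c\<close>, so normality places it in the ring as some \<open>f\<close>. Comparing
  supports in \<open>t^a = f t^b\<close> yields \<open>e\<close> as an exponent of
  \<open>f\<close>.\<close>

lemma normal_imp_saturated:
  fixes A :: "'k::field mpoly set"
  assumes "A \<subseteq> range monom_of" "normal_domain (toric_ring A)"
  shows "saturated (gen_monoid (exponents A))"
  unfolding saturated_def
proof (intro ballI allI impI)
  fix a b c :: "nat \<Rightarrow>\<^sub>0 nat" and n :: nat
  assume abc: "a \<in> gen_monoid (exponents A)" "b \<in> gen_monoid (exponents A)"
      "c \<in> gen_monoid (exponents A)"
    and "n > 0" and eq: "of_nat n * a = of_nat n * b + c"
  let ?E = "(\<lambda>a. Fract a 1) ` toric_ring A"
  have monom: "monom_of s \<in> toric_ring A" if "s \<in> gen_monoid (exponents A)" for s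
    using that by (simp add: toric_ring_eq[OF assms(1)])
  have R: "is_subalgebra (toric_ring A)"
    unfolding toric_ring_eq[OF assms(1)] by (rule is_subalgebra_keys_subset)
  define x :: "'k mpoly fract" where "x = Fract (monom_of a) (monom_of b)"
  define p where "p = monom 1 n - [:Fract (monom_of c :: 'k mpoly) 1:]"
  have "x ^ n = Fract (monom_of a ^ n) (monom_of b ^ n)"
    unfolding x_def by (induction n) (simp_all add: One_fract_def)
  moreover have "monom_of a ^ n = monom_of c * (monom_of b ^ n :: 'k mpoly)"
    unfolding monom_of_power eq monom_of_add by (rule mult.commute)
  ultimately have "x ^ n = Fract (monom_of c) 1"
    by (simp add: eq_fract)
  then have "poly p x = 0"
    by (simp add: p_def poly_monom)
  moreover have "coeff p i \<in> ?E" for i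
  proof -
    \<comment> \<open>As \<open>n > 0\<close>, the top coefficient and the constant term do not
      collide.\<close>
    have "coeff p i = Fract (if i = n then 1 else if i = 0 then - monom_of c else 0) 1"
      using \<open>n > 0\<close> by (auto simp: p_def coeff_pCons Zero_fract_def One_fract_def split: nat.splits)
    then show ?thesis
      using R monom[OF abc(3)] by (auto intro!: imageI subalgebra_0 subalgebra_1 subalgebra_uminus)
  qed
  moreover have "lead_coeff p = 1"
  proof -
    have "degree p = n"
      unfolding p_def using \<open>n > 0\<close>
      by (intro antisym degree_le le_degree) (auto simp: coeff_pCons split: nat.splits)
    then show ?thesis using \<open>n > 0\<close> by (auto simp: p_def coeff_pCons split: nat.splits)
  qed
  ultimately have "integral_over ?E x"
    unfolding integral_over_def by blast
  moreover have "x \<in> fractions_of (toric_ring A)"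
    unfolding fractions_of_def x_def using monom abc monom_of_nonzero by blast
  ultimately obtain f where f: "f \<in> toric_ring A" "x = Fract f 1"
    using assms(2) by (auto simp: normal_domain_def)
  then have "monom_of a = f * monom_of b"
    by (simp add: x_def eq_fract)
  then have "a \<in> Poly_Mapping.keys (f * monom_of b)"
    by (metis keys_monom_of singletonI)
  then obtain e where "e \<in> Poly_Mapping.keys f" "a = b + e"
    using keys_mult[of f "monom_of b"] by (auto simp: add.commute)
  then show "\<exists>e\<in>gen_monoid (exponents A). a = b + e"
    using f(1) by (auto simp: toric_ring_eq[OF assms(1)])
qed

section \<open>The monoid of a nested configuration\<close>

text \<open>A bijection from multisets of indices to exponent vectors. It lets a monomial be handled
  as a collection of single variables that can be split and lifted along maps.\<close>

definition exponent_of_mset :: "nat multiset \<Rightarrow> nat \<Rightarrow>\<^sub>0 nat"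
  where "exponent_of_mset X = (\<Sum>j\<in>#X. Poly_Mapping.single j 1)"

lemma lookup_exponent_of_mset [simp]: "Poly_Mapping.lookup (exponent_of_mset X) j = count X j"
  by (induction X) (simp_all add: exponent_of_mset_def lookup_add lookup_single when_def)

lemma exponent_of_mset_add: "exponent_of_mset (X + Y) = exponent_of_mset X + exponent_of_mset Y"
  by (simp add: exponent_of_mset_def)

lemma exponent_of_mset_inject: "exponent_of_mset X = exponent_of_mset Y \<longleftrightarrow> X = Y"
  by (auto simp: poly_mapping_eq_iff fun_eq_iff multiset_eq_iff)

lemma exponent_of_mset_surj: "\<exists>X. exponent_of_mset X = a"
proof
  show "exponent_of_mset (\<Sum>j\<in>Poly_Mapping.keys a. replicate_mset (Poly_Mapping.lookup a j) j) = a"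
    by (rule poly_mapping_eqI) (auto simp: count_sum in_keys_iff)
qed

lemma degree_exponent_of_mset:
  "(\<Sum>j\<in>Poly_Mapping.keys (exponent_of_mset X). Poly_Mapping.lookup (exponent_of_mset X) j) = size X"
proof -
  have "Poly_Mapping.keys (exponent_of_mset X) = set_mset X"
    by (auto simp: in_keys_iff)
  then show ?thesis by (simp add: size_multiset_overloaded_eq)
qed

text \<open>Projection to the coordinates in \<open>V\<close>. The form as a sum makes additivity
  immediate; for infinite \<open>V\<close> the sum would collapse to 0.\<close>

definition restrict_exponent :: "nat set \<Rightarrow> (nat \<Rightarrow>\<^sub>0 nat) \<Rightarrow> (nat \<Rightarrow>\<^sub>0 nat)"
  where "restrict_exponent V a = (\<Sum>i\<in>V. Poly_Mapping.single i (Poly_Mapping.lookup a i))"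

lemma restrict_exponent_add:
  "restrict_exponent V (a + b) = restrict_exponent V a + restrict_exponent V b"
  by (simp add: restrict_exponent_def lookup_add single_add sum.distrib)

lemma restrict_exponent_0: "restrict_exponent V 0 = 0"
  by (simp add: restrict_exponent_def)

lemma restrict_exponent_of_nat_mult:
  "restrict_exponent V (of_nat n * a) = of_nat n * restrict_exponent V a"
  by (induction n) (simp_all add: restrict_exponent_0 restrict_exponent_add algebra_simps)

lemma restrict_exponent_sum:
  "restrict_exponent V (\<Sum>i\<in>I. a i) = (\<Sum>i\<in>I. restrict_exponent V (a i))"
  by (induction I rule: infinite_finite_induct)
    (simp_all add: restrict_exponent_0 restrict_exponent_add)

lemma restrict_exponent_sum_mset:
  "restrict_exponent V (\<Sum>\<^sub># M) = (\<Sum>a\<in>#M. restrict_exponent V a)"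
  by (induction M) (simp_all add: restrict_exponent_0 restrict_exponent_add)

lemma restrict_exponent_eq_self:
  assumes "finite V" "Poly_Mapping.keys a \<subseteq> V"
  shows "restrict_exponent V a = a"
  using assms
  by (intro poly_mapping_eqI)
    (auto simp: restrict_exponent_def lookup_sum lookup_single when_def in_keys_iff subset_iff)

lemma restrict_exponent_eq_0:
  assumes "Poly_Mapping.keys a \<inter> V = {}"
  shows "restrict_exponent V a = 0"
proof -
  have "Poly_Mapping.single i (Poly_Mapping.lookup a i) = 0" if "i \<in> V" for i
    using assms that by (metis disjoint_iff not_in_keys_iff_lookup_eq_zero single_zero)
  then show ?thesis by (simp add: restrict_exponent_def)
qed

section \<open>Elements of the nested monoid as tuples with a degree vector\<close>

locale nested_exponents =
  fixes d r :: nat and A :: "(nat \<Rightarrow>\<^sub>0 nat) set"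
    and U :: "nat \<Rightarrow> nat set" and B :: "nat \<Rightarrow> (nat \<Rightarrow>\<^sub>0 nat) set"
  assumes A_keys: "a \<in> A \<Longrightarrow> Poly_Mapping.keys a \<subseteq> {1..d}"
    and A_degree: "a \<in> A \<Longrightarrow> (\<Sum>j\<in>Poly_Mapping.keys a. Poly_Mapping.lookup a j) = r"
    and U_finite: "i \<in> {1..d} \<Longrightarrow> finite (U i)"
    and U_disjoint: "disjoint_family_on U {1..d}"
    and B_keys: "i \<in> {1..d} \<Longrightarrow> b \<in> B i \<Longrightarrow> Poly_Mapping.keys b \<subseteq> U i"
    and B_nonempty: "i \<in> {1..d} \<Longrightarrow> B i \<noteq> {}"
    and B_weight: "i \<in> {1..d} \<Longrightarrow>
      \<exists>w :: nat \<Rightarrow> real. \<forall>b\<in>B i. (\<Sum>j\<in>U i. w j * real (Poly_Mapping.lookup b j)) = 1"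
begin

definition nested :: "(nat \<Rightarrow>\<^sub>0 nat) set"
  where "nested = {\<Sum>k=1..r. m k | m i.
    (\<forall>k\<in>{1..r}. i k \<in> {1..d}) \<and> (\<Sum>k=1..r. Poly_Mapping.single (i k) 1) \<in> A \<and>
    (\<forall>k\<in>{1..r}. m k \<in> B (i k))}"

text \<open>A pair \<open>(i, b)\<close> remembers that the factor \<open>b\<close> comes from
  \<open>B i\<close>. First components give the monomial in the \<open>t\<close> variables, second
  components the resulting exponent. Backwards, a decomposition of the first into elements of
  \<open>A\<close> lifts along \<open>fst\<close> to one of \<open>P\<close>, each block being a
  generator.\<close>

lemma nested_iff_labelled:
  "u \<in> gen_monoid nested \<longleftrightarrow>
    (\<exists>P. set_mset P \<subseteq> Sigma {1..d} B \<and> u = (\<Sum>p\<in>#P. snd p) \<and>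
      exponent_of_mset (image_mset fst P) \<in> gen_monoid A)" (is "_ \<longleftrightarrow> ?R u")
proof
  assume "u \<in> gen_monoid nested"
  then obtain M where "set_mset M \<subseteq> nested" "u = \<Sum>\<^sub># M"
    by (rule gen_monoidE)
  then show "?R u"
  proof (induction M arbitrary: u)
    case empty
    then show ?case
      by (intro exI[of _ "{#}"]) (auto simp: exponent_of_mset_def zero_in_gen_monoid)
  next
    case (add v M)
    then obtain P where P: "set_mset P \<subseteq> Sigma {1..d} B" "\<Sum>\<^sub># M = (\<Sum>p\<in>#P. snd p)"
        "exponent_of_mset (image_mset fst P) \<in> gen_monoid A"
      by auto
    have "v \<in> nested" using add.prems by simp
    then obtain m i where v: "v = (\<Sum>k=1..r. m k)" "\<forall>k\<in>{1..r}. i k \<in> {1..d}"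
        "(\<Sum>k=1..r. Poly_Mapping.single (i k) 1) \<in> A" "\<forall>k\<in>{1..r}. m k \<in> B (i k)"
      unfolding nested_def by blast
    define Q where "Q = image_mset (\<lambda>k. (i k, m k)) (mset_set {1..r})"
    have "set_mset Q \<subseteq> Sigma {1..d} B"
      using v unfolding Q_def by auto
    moreover have "(\<Sum>p\<in>#Q. snd p) = v"
      by (simp add: Q_def v(1) sum_unfold_sum_mset multiset.map_comp comp_def)
    moreover have "exponent_of_mset (image_mset fst Q) \<in> A"
      using v(3)
      by (simp add: Q_def exponent_of_mset_def sum_unfold_sum_mset multiset.map_comp comp_def)
    ultimately show ?case
      using P add.prems(2)
      by (intro exI[of _ "Q + P"])
        (auto simp: exponent_of_mset_add intro: gen_monoid_add gen_monoid_generator)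
  qed
next
  assume "?R u"
  then obtain P X where "set_mset P \<subseteq> Sigma {1..d} B" "u = (\<Sum>p\<in>#P. snd p)"
      "set_mset X \<subseteq> A" "exponent_of_mset (image_mset fst P) = \<Sum>\<^sub># X"
    by (auto elim!: gen_monoidE)
  then show "u \<in> gen_monoid nested"
  proof (induction X arbitrary: P u)
    case empty
    have "exponent_of_mset (image_mset fst P) = exponent_of_mset {#}"
      using empty by (simp add: exponent_of_mset_def)
    then have "P = {#}" by (simp only: exponent_of_mset_inject image_mset_is_empty_iff)
    then show ?case using empty by (simp add: zero_in_gen_monoid)
  next
    case (add a X)
    obtain Y Z where YZ: "exponent_of_mset Y = a" "exponent_of_mset Z = \<Sum>\<^sub># X"
      using exponent_of_mset_surj by metis
    then have "exponent_of_mset (image_mset fst P) = exponent_of_mset (Y + Z)"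
      using add.prems by (simp add: exponent_of_mset_add)
    then have "image_mset fst P = Y + Z"
      by (simp only: exponent_of_mset_inject)
    then obtain Q R where QR: "P = Q + R" "Y = image_mset fst Q" "Z = image_mset fst R"
      by (blast dest: image_mset_eq_plusD)
    have "(\<Sum>p\<in>#R. snd p) \<in> gen_monoid nested"
      using add.prems YZ QR by (intro add.IH[of R]) auto
    moreover have "(\<Sum>p\<in>#Q. snd p) \<in> nested"
    proof -
      \<comment> \<open>Homogeneity gives the block exactly \<open>r\<close> members. Listing them
        supplies the sequences in the definition of \<open>nested\<close>, with \<open>k - 1\<close>
        because list positions start at 0.\<close>
      obtain ps where ps: "mset ps = Q" using ex_mset by blast
      have "size Q = r"
        using A_degree[of a] add.prems YZ QR degree_exponent_of_mset[of Y] by simp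
      then have "length ps = r" using ps size_mset by metis
      have sum_nth: "(\<Sum>k=1..r. f (ps ! (k - 1))) = (\<Sum>p\<in>#Q. f p)"
        for f :: "_ \<Rightarrow> nat \<Rightarrow>\<^sub>0 nat"
        using \<open>length ps = r\<close>
        by (simp add: sum_mset_sum_list sum_list_sum_nth sum.atLeast1_atMost_eq atLeast0LessThan
            flip: ps mset_map)
      have in_Q: "ps ! (k - 1) \<in># Q" if "k \<in> {1..r}" for k
        using that \<open>length ps = r\<close> by (auto simp flip: ps)
      have Q: "set_mset Q \<subseteq> Sigma {1..d} B" using add.prems(1) QR by auto
      have "exponent_of_mset (image_mset fst Q) \<in> A" using add.prems YZ QR by simp
      then have "(\<Sum>k=1..r. Poly_Mapping.single (fst (ps ! (k - 1))) 1) \<in> A"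
        using sum_nth[of "\<lambda>p. Poly_Mapping.single (fst p) 1"]
        by (simp add: exponent_of_mset_def multiset.map_comp comp_def)
      moreover have "fst (ps ! (k - 1)) \<in> {1..d} \<and> snd (ps ! (k - 1)) \<in> B (fst (ps ! (k - 1)))"
        if "k \<in> {1..r}" for k
        using in_Q[OF that] Q by (cases "ps ! (k - 1)") auto
      ultimately show ?thesis
        unfolding nested_def mem_Collect_eq
        by (intro exI[of _ "\<lambda>k. snd (ps ! (k - 1))"] exI[of _ "\<lambda>k. fst (ps ! (k - 1))"])
          (auto simp: sum_nth[of snd, simplified])
    qed
    ultimately show ?case
      using add.prems QR by (simp add: gen_monoid_add gen_monoid_generator)
  qed
qed

text \<open>The exponent of the monomial in the \<open>t\<close> variables below a tuple: each
  factor from \<open>B i\<close> stands for one \<open>t_i\<close>.\<close>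

definition size_vector :: "(nat \<Rightarrow> (nat \<Rightarrow>\<^sub>0 nat) multiset) \<Rightarrow> nat \<Rightarrow>\<^sub>0 nat"
  where "size_vector E = (\<Sum>i=1..d. Poly_Mapping.single i (size (E i)))"

lemma lookup_size_vector:
  "Poly_Mapping.lookup (size_vector E) i = (if i \<in> {1..d} then size (E i) else 0)"
  by (simp add: size_vector_def lookup_sum lookup_single when_def)

text \<open>Sorting a labelled multiset by its labels gives the tuple \<open>E\<close>; tagging the
  members of each \<open>E i\<close> with \<open>i\<close> goes back.\<close>

lemma nested_iff:
  "u \<in> gen_monoid nested \<longleftrightarrow>
    (\<exists>E. (\<forall>i\<in>{1..d}. set_mset (E i) \<subseteq> B i) \<and> u = (\<Sum>i=1..d. \<Sum>\<^sub># (E i)) \<and>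
      size_vector E \<in> gen_monoid A)"
  unfolding nested_iff_labelled
proof (intro iffI; elim exE conjE)
  fix P assume P: "set_mset P \<subseteq> Sigma {1..d} B" "u = (\<Sum>p\<in>#P. snd p)"
    "exponent_of_mset (image_mset fst P) \<in> gen_monoid A"
  define E where "E Q i = image_mset snd (filter_mset (\<lambda>p. fst p = i) Q)"
    for Q :: "(nat \<times> (nat \<Rightarrow>\<^sub>0 nat)) multiset" and i
  have "(\<Sum>p\<in>#Q. snd p) = (\<Sum>i=1..d. \<Sum>\<^sub># (E Q i))" if "set_mset Q \<subseteq> Sigma {1..d} B" for Q
    using that
  proof (induction Q)
    case empty
    then show ?case by (simp add: E_def)
  next
    case (add p Q)
    have "\<Sum>\<^sub># (E (add_mset p Q) i) = (if i = fst p then snd p else 0) + \<Sum>\<^sub># (E Q i)" for i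
      by (simp add: E_def)
    moreover have "fst p \<in> {1..d}" using add.prems by auto
    ultimately show ?case using add by (simp add: sum.distrib)
  qed
  moreover have "size_vector (E P) = exponent_of_mset (image_mset fst P)"
  proof (rule poly_mapping_eqI)
    fix i
    have "size (E Q i) = count (image_mset fst Q) i" for Q
      by (induction Q) (auto simp: E_def)
    moreover have "count (image_mset fst P) i = 0" if "i \<notin> {1..d}"
      using that P(1) by (auto simp: count_eq_zero_iff)
    ultimately show "Poly_Mapping.lookup (size_vector (E P)) i =
        Poly_Mapping.lookup (exponent_of_mset (image_mset fst P)) i"
      by (simp add: lookup_size_vector)
  qed
  ultimately show "\<exists>E. (\<forall>i\<in>{1..d}. set_mset (E i) \<subseteq> B i) \<and> u = (\<Sum>i=1..d. \<Sum>\<^sub># (E i)) \<and>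
      size_vector E \<in> gen_monoid A"
    using P by (intro exI[of _ "E P"]) (auto simp: E_def)
next
  fix E assume E: "\<forall>i\<in>{1..d}. set_mset (E i) \<subseteq> B i" "u = (\<Sum>i=1..d. \<Sum>\<^sub># (E i))"
    "size_vector E \<in> gen_monoid A"
  define P where "P I = (\<Sum>i\<in>I. image_mset (Pair i) (E i))" for I
  have "set_mset (P {1..d}) \<subseteq> Sigma {1..d} B"
    using E(1) by (force simp: P_def set_mset_sum)
  moreover have "(\<Sum>p\<in>#P I. snd p) = (\<Sum>i\<in>I. \<Sum>\<^sub># (E i))" for I
    unfolding P_def
    by (induction I rule: infinite_finite_induct) (simp_all add: multiset.map_comp comp_def)
  moreover have "exponent_of_mset (image_mset fst (P {1..d})) = size_vector E"
  proof (rule poly_mapping_eqI)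
    fix j
    have "count (image_mset (\<lambda>x. i) (E i)) j = (if i = j then size (E i) else 0)" for i
      by (simp add: image_mset_const_eq)
    moreover have "image_mset fst (P I) = (\<Sum>i\<in>I. image_mset (\<lambda>x. i) (E i))" for I
      unfolding P_def
      by (induction I rule: infinite_finite_induct) (simp_all add: multiset.map_comp comp_def)
    ultimately show "Poly_Mapping.lookup (exponent_of_mset (image_mset fst (P {1..d}))) j =
        Poly_Mapping.lookup (size_vector E) j"
      by (simp add: lookup_size_vector count_sum)
  qed
  ultimately show "\<exists>P. set_mset P \<subseteq> Sigma {1..d} B \<and> u = (\<Sum>p\<in>#P. snd p) \<and>
      exponent_of_mset (image_mset fst P) \<in> gen_monoid A"
    using E by (intro exI[of _ "P {1..d}"]) auto
qed

text \<open>The variable sets are disjoint, so projecting to \<open>U i\<close> kills all other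
  components. Hence an equation in the nested monoid can be read component by component.\<close>

lemma restrict_nested:
  assumes E: "\<forall>i\<in>{1..d}. set_mset (E i) \<subseteq> B i" and i: "i \<in> {1..d}"
  shows "restrict_exponent (U i) (\<Sum>j=1..d. \<Sum>\<^sub># (E j)) = \<Sum>\<^sub># (E i)"
proof -
  have "restrict_exponent (U i) (\<Sum>\<^sub># (E j)) = (if i = j then \<Sum>\<^sub># (E i) else 0)"
    if j: "j \<in> {1..d}" for j
  proof -
    have "restrict_exponent (U i) b = (if i = j then b else 0)" if "b \<in># E j" for b
    proof -
      have "Poly_Mapping.keys b \<subseteq> U j" using E j that B_keys by blast
      moreover have "U i \<inter> U j = {}" if "i \<noteq> j"
        using U_disjoint i j that by (simp add: disjoint_family_on_def)
      ultimately show ?thesis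
        using U_finite[OF i] by (auto intro!: restrict_exponent_eq_self restrict_exponent_eq_0)
    qed
    then have "image_mset (restrict_exponent (U i)) (E j) = image_mset (\<lambda>b. if i = j then b else 0) (E j)"
      by (intro image_mset_cong) simp
    then show ?thesis by (simp add: restrict_exponent_sum_mset)
  qed
  then show ?thesis using i by (simp add: restrict_exponent_sum)
qed

text \<open>The weight extends to an additive functional \<open>h\<close> that is 1 on every
  generator, so \<open>h\<close> of a sum counts its generators. Applying \<open>h\<close> to the
  equation compares degrees.\<close>

lemma size_eqI:
  assumes i: "i \<in> {1..d}" and MNK: "set_mset M \<subseteq> B i" "set_mset N \<subseteq> B i" "set_mset K \<subseteq> B i"
    and eq: "of_nat n * \<Sum>\<^sub># M = of_nat n * \<Sum>\<^sub># N + \<Sum>\<^sub># K"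
  shows "n * size M = n * size N + size K"
proof -
  obtain w :: "nat \<Rightarrow> real" where w: "\<forall>b\<in>B i. (\<Sum>j\<in>U i. w j * real (Poly_Mapping.lookup b j)) = 1"
    using B_weight[OF i] by blast
  define h where "h a = (\<Sum>j\<in>U i. w j * real (Poly_Mapping.lookup a j))" for a
  have h_add: "h (a + b) = h a + h b" for a b
    by (simp add: h_def lookup_add algebra_simps sum.distrib)
  have h_0: "h 0 = 0" by (simp add: h_def)
  have h_mult: "h (of_nat n * a) = real n * h a" for a
    by (simp add: h_def lookup_of_nat_mult sum_distrib_left mult.left_commute)
  have h_size: "h (\<Sum>\<^sub># L) = real (size L)" if "set_mset L \<subseteq> B i" for L
    using that
  proof (induction L)
    case (add b L)
    then have "h b = 1" using w by (simp add: h_def)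
    then show ?case using add by (simp add: h_add)
  qed (simp add: h_0)
  have "real (n * size M) = real (n * size N + size K)"
    using arg_cong[OF eq, of h] MNK by (simp add: h_add h_mult h_size)
  then show ?thesis by (rule of_nat_eq_iff[THEN iffD1])
qed

section \<open>Transfer of saturation\<close>

text \<open>Saturation of each \<open>B i\<close> divides componentwise and gives a tuple
  \<open>E\<close>. Saturation of \<open>A\<close>, applied to the degree vectors, shows that the
  degree vector of \<open>E\<close> is admissible.\<close>

lemma saturated_nested:
  assumes "saturated (gen_monoid A)" and "\<forall>i\<in>{1..d}. saturated (gen_monoid (B i))"
  shows "saturated (gen_monoid nested)"
  unfolding saturated_def
proof (intro ballI allI impI)
  fix u v c and n :: nat
  assume "u \<in> gen_monoid nested" "v \<in> gen_monoid nested" "c \<in> gen_monoid nested"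
    and "n > 0" and eq: "of_nat n * u = of_nat n * v + c"
  then obtain P Q R where P: "\<forall>i\<in>{1..d}. set_mset (P i) \<subseteq> B i" "u = (\<Sum>i=1..d. \<Sum>\<^sub># (P i))"
      "size_vector P \<in> gen_monoid A"
    and Q: "\<forall>i\<in>{1..d}. set_mset (Q i) \<subseteq> B i" "v = (\<Sum>i=1..d. \<Sum>\<^sub># (Q i))"
      "size_vector Q \<in> gen_monoid A"
    and R: "\<forall>i\<in>{1..d}. set_mset (R i) \<subseteq> B i" "c = (\<Sum>i=1..d. \<Sum>\<^sub># (R i))"
      "size_vector R \<in> gen_monoid A"
    unfolding nested_iff by blast
  have eq_i: "of_nat n * \<Sum>\<^sub># (P i) = of_nat n * \<Sum>\<^sub># (Q i) + \<Sum>\<^sub># (R i)" if "i \<in> {1..d}" for i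
    using arg_cong[OF eq, of "restrict_exponent (U i)"]
      restrict_nested[OF P(1) that] restrict_nested[OF Q(1) that] restrict_nested[OF R(1) that]
    by (simp add: restrict_exponent_add restrict_exponent_of_nat_mult P(2) Q(2) R(2))
  have "\<exists>E. set_mset E \<subseteq> B i \<and> \<Sum>\<^sub># (P i) = \<Sum>\<^sub># (Q i) + \<Sum>\<^sub># E" if i: "i \<in> {1..d}" for i
  proof -
    have "\<Sum>\<^sub># (P i) \<in> gen_monoid (B i)" "\<Sum>\<^sub># (Q i) \<in> gen_monoid (B i)"
        "\<Sum>\<^sub># (R i) \<in> gen_monoid (B i)"
      using P Q R i by (simp_all add: gen_monoidI)
    then have "\<exists>e\<in>gen_monoid (B i). \<Sum>\<^sub># (P i) = \<Sum>\<^sub># (Q i) + e"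
      using assms(2) eq_i[OF i] i \<open>n > 0\<close> unfolding saturated_def by meson
    then show ?thesis by (metis gen_monoidE)
  qed
  then obtain E where E: "\<And>i. i \<in> {1..d} \<Longrightarrow> set_mset (E i) \<subseteq> B i"
      "\<And>i. i \<in> {1..d} \<Longrightarrow> \<Sum>\<^sub># (P i) = \<Sum>\<^sub># (Q i) + \<Sum>\<^sub># (E i)"
    by metis
  have size_E: "size (P i) = size (Q i) + size (E i)" if i: "i \<in> {1..d}" for i
    using size_eqI[OF i, of "P i" "Q i" "E i" 1] E P Q i by simp
  have "of_nat n * size_vector P = of_nat n * size_vector Q + size_vector R"
    using size_eqI eq_i P Q R
    by (intro poly_mapping_eqI) (simp add: lookup_add lookup_of_nat_mult lookup_size_vector)
  then obtain e where e: "e \<in> gen_monoid A" "size_vector P = size_vector Q + e"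
    using assms(1) P Q R \<open>n > 0\<close> unfolding saturated_def by meson
  \<comment> \<open>Both \<open>e\<close> and \<open>size_vector E\<close> complete
    \<open>size_vector Q\<close> to \<open>size_vector P\<close>, so by cancellation they
    agree.\<close>
  have "size_vector P = size_vector Q + size_vector E"
    using size_E by (intro poly_mapping_eqI) (simp add: lookup_add lookup_size_vector)
  then have "size_vector E \<in> gen_monoid A"
    using e by simp
  then have "(\<Sum>i=1..d. \<Sum>\<^sub># (E i)) \<in> gen_monoid nested"
    using E(1) unfolding nested_iff by blast
  moreover have "u = v + (\<Sum>i=1..d. \<Sum>\<^sub># (E i))"
    by (simp add: P(2) Q(2) E(2) flip: sum.distrib)
  ultimately show "\<exists>e\<in>gen_monoid nested. u = v + e" by blast
qed

lemma choose_generators: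
  obtains m where "\<And>i. i \<in> {1..d} \<Longrightarrow> m i \<in> B i"
proof
  show "(SOME b. b \<in> B i) \<in> B i" if "i \<in> {1..d}" for i
    using B_nonempty[OF that] by (simp add: some_in_eq)
qed

lemma gen_monoid_A_keys: "a \<in> gen_monoid A \<Longrightarrow> i \<notin> {1..d} \<Longrightarrow> Poly_Mapping.lookup a i = 0"
  using A_keys by (force elim!: gen_monoidE simp: lookup_sum_mset in_keys_iff)

text \<open>Substituting a fixed generator \<open>m i\<close> for each \<open>t_i\<close> is an
  additive map \<open>u\<close> into the nested monoid that keeps degree vectors. A quotient found
  there is sent back to \<open>A\<close> by its degree vector.\<close>

lemma saturated_A:
  assumes "saturated (gen_monoid nested)"
  shows "saturated (gen_monoid A)"
  unfolding saturated_def
proof (intro ballI allI impI)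
  fix a b c and n :: nat
  assume abc: "a \<in> gen_monoid A" "b \<in> gen_monoid A" "c \<in> gen_monoid A"
    and "n > 0" and eq: "of_nat n * a = of_nat n * b + c"
  obtain m where m: "\<And>i. i \<in> {1..d} \<Longrightarrow> m i \<in> B i"
    using choose_generators by blast
  define E where "E a i = replicate_mset (Poly_Mapping.lookup a i) (m i)" for a :: "nat \<Rightarrow>\<^sub>0 nat" and i
  define u where "u a = (\<Sum>i=1..d. \<Sum>\<^sub># (E a i))" for a
  have EB: "\<forall>i\<in>{1..d}. set_mset (E a i) \<subseteq> B i" for a
    using m by (auto simp: E_def set_mset_replicate_mset_subset)
  have u_nested: "u x \<in> gen_monoid nested" if "x \<in> gen_monoid A" for x
  proof -
    have "size_vector (E x) = x"
      using gen_monoid_A_keys[OF that]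
      by (intro poly_mapping_eqI) (auto simp: lookup_size_vector E_def)
    then show ?thesis unfolding nested_iff u_def using EB that by metis
  qed
  have u_add: "u (x + y) = u x + u y" for x y
    by (simp add: u_def E_def lookup_add algebra_simps sum.distrib)
  have "u (of_nat n * x) = of_nat n * u x" for x
    by (simp add: u_def E_def lookup_of_nat_mult sum_distrib_left mult.assoc)
  then have "of_nat n * u a = of_nat n * u b + u c"
    using arg_cong[OF eq, of u] by (simp add: u_add)
  then obtain e where "e \<in> gen_monoid nested" "u a = u b + e"
    using assms u_nested[OF abc(1)] u_nested[OF abc(2)] u_nested[OF abc(3)] \<open>n > 0\<close>
    unfolding saturated_def by meson
  then obtain F where F: "\<forall>i\<in>{1..d}. set_mset (F i) \<subseteq> B i" "size_vector F \<in> gen_monoid A"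
      "u a = u b + (\<Sum>i=1..d. \<Sum>\<^sub># (F i))"
    unfolding nested_iff by blast
  have "Poly_Mapping.lookup a i = Poly_Mapping.lookup b i + size (F i)" if i: "i \<in> {1..d}" for i
  proof -
    have "\<Sum>\<^sub># (E a i) = \<Sum>\<^sub># (E b i) + \<Sum>\<^sub># (F i)"
      using arg_cong[OF F(3), of "restrict_exponent (U i)"] restrict_nested[OF EB i]
        restrict_nested[OF F(1) i]
      by (simp add: u_def restrict_exponent_add)
    then show ?thesis
      using size_eqI[OF i, of "E a i" "E b i" "F i" 1] EB F(1) i by (simp add: E_def)
  qed
  then have "a = b + size_vector F"
    using gen_monoid_A_keys abc
    by (intro poly_mapping_eqI) (simp add: lookup_add lookup_size_vector)
  then show "\<exists>e\<in>gen_monoid A. a = b + e"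
    using F(2) by blast
qed

text \<open>
  Since \<open>a\<close> has \<open>i\<close>-th entry 1, an element of degree \<open>s\<close> in the \<open>i\<close>-th monoid is completed to an
  element of the nested monoid lying over \<open>s a\<close>.
\<close>

lemma saturated_B:
  assumes "saturated (gen_monoid nested)" and i: "i \<in> {1..d}"
    and a: "a \<in> A" "Poly_Mapping.lookup a i = 1"
  shows "saturated (gen_monoid (B i))"
  unfolding saturated_def
proof (intro ballI allI impI)
  fix x y z and n :: nat
  assume "x \<in> gen_monoid (B i)" "y \<in> gen_monoid (B i)" "z \<in> gen_monoid (B i)"
    and "n > 0" and eq: "of_nat n * x = of_nat n * y + z"
  then obtain M N K where M: "set_mset M \<subseteq> B i" "x = \<Sum>\<^sub># M"
    and N: "set_mset N \<subseteq> B i" "y = \<Sum>\<^sub># N" and K: "set_mset K \<subseteq> B i" "z = \<Sum>\<^sub># K"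
    by (auto elim!: gen_monoidE)
  \<comment> \<open>The degrees satisfy the same equation, so the padding added in proportion to
    degree balances on both sides.\<close>
  have size: "n * size M = n * size N + size K"
    using size_eqI[OF i M(1) N(1) K(1)] eq M N K by simp
  obtain m where m: "\<And>i. i \<in> {1..d} \<Longrightarrow> m i \<in> B i"
    using choose_generators by blast
  \<comment> \<open>Component \<open>i\<close> is \<open>L\<close> itself; the others are padded so
    that the degree vector is \<open>size L\<close> times \<open>a\<close>, using that
    \<open>a\<close> has entry 1 at \<open>i\<close>.\<close>
  define E where "E L j = (if j = i then L else replicate_mset (size L * Poly_Mapping.lookup a j) (m j))"
    for L j
  define u where "u L = (\<Sum>j=1..d. \<Sum>\<^sub># (E L j))" for L
  \<comment> \<open>The padding for one unit of degree. It lies outside component \<open>i\<close>,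
    so the final projection to \<open>U i\<close> removes it.\<close>
  define t where "t = (\<Sum>j\<in>{1..d} - {i}. of_nat (Poly_Mapping.lookup a j) * m j)"
  have EB: "\<forall>j\<in>{1..d}. set_mset (E L j) \<subseteq> B j" if "set_mset L \<subseteq> B i" for L
    using that m by (auto simp: E_def set_mset_replicate_mset_subset)
  have u_nested: "u L \<in> gen_monoid nested" if "set_mset L \<subseteq> B i" for L
  proof -
    have "size_vector (E L) = of_nat (size L) * a"
      using gen_monoid_A_keys[OF gen_monoid_generator[OF a(1)]] a(2)
      by (intro poly_mapping_eqI) (auto simp: lookup_size_vector lookup_of_nat_mult E_def)
    then have "size_vector (E L) \<in> gen_monoid A"
      using a(1) by (simp add: gen_monoid_of_nat_mult gen_monoid_generator)
    then show ?thesis unfolding nested_iff u_def using EB[OF that] by blast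
  qed
  have u_eq: "u L = \<Sum>\<^sub># L + of_nat (size L) * t" for L
  proof -
    have "u L = \<Sum>\<^sub># (E L i) + (\<Sum>j\<in>{1..d} - {i}. \<Sum>\<^sub># (E L j))"
      unfolding u_def using i by (intro sum.remove) auto
    also have "(\<Sum>j\<in>{1..d} - {i}. \<Sum>\<^sub># (E L j)) = of_nat (size L) * t"
      unfolding t_def sum_distrib_left by (intro sum.cong) (auto simp: E_def mult_ac)
    finally show ?thesis by (simp add: E_def)
  qed
  have "of_nat n * u M = of_nat n * \<Sum>\<^sub># M + of_nat (n * size M) * t"
    by (simp add: u_eq algebra_simps)
  also have "\<dots> = of_nat n * \<Sum>\<^sub># N + \<Sum>\<^sub># K + of_nat (n * size N + size K) * t"
    unfolding size using eq M N K by simp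
  also have "\<dots> = of_nat n * u N + u K"
    by (simp add: u_eq algebra_simps)
  finally obtain e where "e \<in> gen_monoid nested" "u M = u N + e"
    using assms(1) u_nested[OF M(1)] u_nested[OF N(1)] u_nested[OF K(1)] \<open>n > 0\<close>
    unfolding saturated_def by meson
  then obtain F where F: "\<forall>j\<in>{1..d}. set_mset (F j) \<subseteq> B j" "u M = u N + (\<Sum>j=1..d. \<Sum>\<^sub># (F j))"
    unfolding nested_iff by blast
  have "\<Sum>\<^sub># (E M i) = \<Sum>\<^sub># (E N i) + \<Sum>\<^sub># (F i)"
    using arg_cong[OF F(2), of "restrict_exponent (U i)"] restrict_nested[OF EB[OF M(1)] i]
      restrict_nested[OF EB[OF N(1)] i] restrict_nested[OF F(1) i]
    by (simp add: u_def restrict_exponent_add)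
  then have "x = y + \<Sum>\<^sub># (F i)"
    by (simp add: E_def M N)
  then show "\<exists>e\<in>gen_monoid (B i). x = y + e"
    using F(1) i gen_monoidI by blast
qed

end

section \<open>Normality of nested configurations\<close>

lemma configuration_subset_range: "configuration V A \<Longrightarrow> A \<subseteq> range monom_of"
  by (auto simp: configuration_def monomials_def)

lemma keys_exponents_subset:
  fixes A :: "'k::field mpoly set"
  assumes "configuration V A" "a \<in> exponents A"
  shows "Poly_Mapping.keys a \<subseteq> V"
proof -
  have "(monom_of a :: 'k mpoly) \<in> monomials V"
    using assms by (auto simp: configuration_def exponents_def)
  then show ?thesis by (auto simp: monomials_def)
qed

lemma normal_iff_saturated:
  assumes "finite A" "A \<subseteq> range monom_of"
  shows "normal_domain (toric_ring A) \<longleftrightarrow> saturated (gen_monoid (exponents A))"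
  using assms normal_imp_saturated saturated_imp_normal by blast

text \<open>Products of monomials become sums of exponents, which brings the polynomial definition
  into the form of \<open>nested\<close>.\<close>

lemma exponents_nested_configuration:
  assumes "\<And>i. i \<in> {1..d} \<Longrightarrow> B i \<subseteq> range monom_of"
  shows "exponents (nested_configuration d r A B) =
    {\<Sum>k=1..r. m k | m i. (\<forall>k\<in>{1..r}. i k \<in> {1..d}) \<and>
      (\<Sum>k=1..r. Poly_Mapping.single (i k) 1) \<in> exponents A \<and> (\<forall>k\<in>{1..r}. m k \<in> exponents (B (i k)))}"
    (is "_ = ?R")
proof (intro equalityI subsetI)
  fix u assume "u \<in> exponents (nested_configuration d r A B)"
  then obtain m i where u: "monom_of u = (\<Prod>k=1..r. m k)" "\<forall>k\<in>{1..r}. i k \<in> {1..d}"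
      "(\<Prod>k=1..r. var (i k)) \<in> A" "\<forall>k\<in>{1..r}. m k \<in> B (i k)"
    unfolding exponents_def nested_configuration_def by blast
  have "\<forall>k\<in>{1..r}. \<exists>a. m k = monom_of a"
    using assms u by blast
  then obtain a where a: "\<forall>k\<in>{1..r}. m k = monom_of (a k)"
    by metis
  then have "(\<Prod>k=1..r. m k) = monom_of (\<Sum>k=1..r. a k)"
    unfolding monom_of_sum by (intro prod.cong) auto
  then have "u = (\<Sum>k=1..r. a k)" using u by simp
  then show "u \<in> ?R"
    using u a unfolding exponents_def var_def monom_of_sum[symmetric]
    by (intro CollectI exI[of _ a] exI[of _ i]) auto
next
  fix u assume "u \<in> ?R"
  then obtain m i where "u = (\<Sum>k=1..r. m k)" "\<forall>k\<in>{1..r}. i k \<in> {1..d}"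
      "(\<Sum>k=1..r. Poly_Mapping.single (i k) 1) \<in> exponents A" "\<forall>k\<in>{1..r}. m k \<in> exponents (B (i k))"
    by blast
  then show "u \<in> exponents (nested_configuration d r A B)"
    unfolding exponents_def nested_configuration_def var_def
    by (intro CollectI exI[of _ "\<lambda>k. monom_of (m k)"] exI[of _ i]) (auto simp flip: monom_of_sum)
qed

lemma nested_configuration_subset_range:
  assumes "\<And>i. i \<in> {1..d} \<Longrightarrow> B i \<subseteq> range monom_of"
  shows "nested_configuration d r A B \<subseteq> range monom_of"
proof
  fix f assume "f \<in> nested_configuration d r A B"
  then obtain m i where f: "f = (\<Prod>k=1..r. m k)" "\<forall>k\<in>{1..r}. i k \<in> {1..d}" "\<forall>k\<in>{1..r}. m k \<in> B (i k)"
    unfolding nested_configuration_def by blast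
  then have "\<forall>k\<in>{1..r}. \<exists>a. m k = monom_of a"
    using assms by blast
  then obtain a where "\<forall>k\<in>{1..r}. m k = monom_of (a k)"
    by metis
  then have "f = monom_of (\<Sum>k=1..r. a k)"
    unfolding f monom_of_sum by (intro prod.cong) auto
  then show "f \<in> range monom_of" by simp
qed

text \<open>Only the values of \<open>m\<close> on \<open>{1..r}\<close> enter the product, so the
  choices may be taken from a finite space of functions.\<close>

lemma finite_nested_configuration:
  assumes "\<And>i. i \<in> {1..d} \<Longrightarrow> finite (B i)"
  shows "finite (nested_configuration d r A B)"
proof (rule finite_subset)
  show "finite ((\<lambda>m. \<Prod>k=1..r. m k) ` ({1..r} \<rightarrow>\<^sub>E (\<Union>i\<in>{1..d}. B i)))"
    using assms by (intro finite_imageI finite_PiE) auto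
  show "nested_configuration d r A B \<subseteq> (\<lambda>m. \<Prod>k=1..r. m k) ` ({1..r} \<rightarrow>\<^sub>E (\<Union>i\<in>{1..d}. B i))"
  proof
    fix f assume "f \<in> nested_configuration d r A B"
    then obtain m i where f: "f = (\<Prod>k=1..r. m k)" "\<forall>k\<in>{1..r}. i k \<in> {1..d}" "\<forall>k\<in>{1..r}. m k \<in> B (i k)"
      unfolding nested_configuration_def by blast
    then have "f = (\<Prod>k=1..r. restrict m {1..r} k)"
      by (auto intro: prod.cong)
    moreover have "restrict m {1..r} \<in> {1..r} \<rightarrow>\<^sub>E (\<Union>i\<in>{1..d}. B i)"
      using f by fastforce
    ultimately show "f \<in> (\<lambda>m. \<Prod>k=1..r. m k) ` ({1..r} \<rightarrow>\<^sub>E (\<Union>i\<in>{1..d}. B i))"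
      by blast
  qed
qed

theorem corollary1p9:
  fixes d r :: nat
    and A :: "'k::field mpoly set"
    and U :: "nat \<Rightarrow> nat set"
    and B :: "nat \<Rightarrow> 'k mpoly set"
  assumes "configuration {1..d} A"
    and "homogeneous_of_degree r A"
    and "\<forall>i\<in>{1..d}. \<exists>f\<in>A. var i dvd f"
    and "\<forall>i\<in>{1..d}. finite (U i)"
    and "disjoint_family_on U {1..d}"
    and "\<forall>i\<in>{1..d}. configuration (U i) (B i)"
    and "squarefree_monomials A"
  shows "(normal_domain (toric_ring A) \<and> (\<forall>i\<in>{1..d}. normal_domain (toric_ring (B i))))
    \<longleftrightarrow> normal_domain (toric_ring (nested_configuration d r A B))"
proof -
  interpret nested_exponents d r "exponents A" U "\<lambda>i. exponents (B i)"
  proof unfold_locales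
    show "Poly_Mapping.keys a \<subseteq> {1..d}" if "a \<in> exponents A" for a
      using keys_exponents_subset[OF assms(1) that] .
    show "(\<Sum>j\<in>Poly_Mapping.keys a. Poly_Mapping.lookup a j) = r" if "a \<in> exponents A" for a
      using assms(2) that by (simp add: homogeneous_of_degree_def exponents_def)
  next
    fix i assume "i \<in> {1..d}"
    then have B: "configuration (U i) (B i)" using assms(6) by blast
    show "Poly_Mapping.keys b \<subseteq> U i" if "b \<in> exponents (B i)" for b
      using keys_exponents_subset[OF B that] .
    obtain f where "f \<in> B i"
      using B by (auto simp: configuration_def)
    then show "exponents (B i) \<noteq> {}"
      using configuration_subset_range[OF B] by (auto simp: exponents_def)
    show "\<exists>w :: nat \<Rightarrow> real. \<forall>b\<in>exponents (B i). (\<Sum>j\<in>U i. w j * real (Poly_Mapping.lookup b j)) = 1"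
      using B by (simp add: configuration_def exponents_def)
  qed (use assms in auto)
  have A: "finite A" "A \<subseteq> range monom_of"
    using assms(1) configuration_subset_range[OF assms(1)] by (simp_all add: configuration_def)
  have B: "finite (B i)" "B i \<subseteq> range monom_of" if "i \<in> {1..d}" for i
  proof -
    have "configuration (U i) (B i)" using assms(6) that by blast
    then show "finite (B i)" "B i \<subseteq> range monom_of"
      using configuration_subset_range[of "U i" "B i"] by (simp_all add: configuration_def)
  qed
  \<comment> \<open>Divisibility by \<open>var i\<close> makes the entry at least 1 and
    squarefreeness at most 1; this is the monomial that \<open>saturated_B\<close> requires.\<close>
  have "\<exists>a\<in>exponents A. Poly_Mapping.lookup a i = 1" if i: "i \<in> {1..d}" for i
  proof -
    obtain f where f: "f \<in> A" "var i dvd f"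
      using assms(3) i by blast
    obtain a where "f = monom_of a"
      using f(1) A(2) by blast
    moreover obtain g where "f = var i * g"
      using f(2) by (rule dvdE)
    ultimately have a: "monom_of a \<in> A" "monom_of a = var i * g"
      using f(1) by simp_all
    then have "a \<in> Poly_Mapping.keys (var i * g)"
      by (metis keys_monom_of singletonI)
    then obtain b where "a = Poly_Mapping.single i 1 + b"
      using keys_mult[of "var i" g] by (auto simp: var_def)
    then have "1 \<le> Poly_Mapping.lookup a i"
      by (simp add: lookup_add)
    moreover have "Poly_Mapping.lookup a i \<le> 1"
      using assms(7) a by (simp add: squarefree_monomials_def)
    ultimately show ?thesis using a by (intro bexI[of _ a]) (auto simp: exponents_def)
  qed
  then have "saturated (gen_monoid (exponents (B i)))" if "saturated (gen_monoid nested)" "i \<in> {1..d}" for i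
    using saturated_B[OF that] that(2) by blast
  then have "saturated (gen_monoid nested) \<longleftrightarrow>
      saturated (gen_monoid (exponents A)) \<and> (\<forall>i\<in>{1..d}. saturated (gen_monoid (exponents (B i))))"
    using saturated_nested saturated_A by auto
  moreover have "exponents (nested_configuration d r A B) = nested"
    unfolding nested_def using B by (intro exponents_nested_configuration)
  moreover have "finite (nested_configuration d r A B)"
      "nested_configuration d r A B \<subseteq> range monom_of"
    using B finite_nested_configuration nested_configuration_subset_range by metis+
  ultimately show ?thesis
    using A B by (simp only: normal_iff_saturated ball_simps cong: ball_cong)
qed

end
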